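(* Let $K$ be a finite flag simplicial complex and let $J=J(K)$ be the anti-incidence matrix of $K$. Then every column of $J$ has sum $\bar{\boldsymbol\chi}(K)$. If, in addition, $K$ is an Eulerian sphere (of some dimension $k$), then $J^2=\mathrm{Id}$.
   Context: $K$ is a finite simplicial complex; $\mathcal{P}=\mathcal{P}(K)$ is the set of its simplices including the empty simplex $\emptyset$, with $\dim\emptyset=-1$. $K$ is flag if any set of pairwise adjacent vertices (vertices spanning an edge) spans a simplex of $K$. The reduced Euler characteristic is $\bar{\boldsymbol\chi}(K)=\sum_{\sigma\in\mathcal{P}(K)}(-1)^{\dim\sigma}$ (empty simplex included). $\mathrm{St}(\sigma)$ is the subcomplex which is the union of all simplices $\tau$ such that $\tau$ and $\sigma$ span a simplex of $K$; $\mathrm{Lk}(\sigma)$ is the union of all simplices $\tau$ in $\mathrm{St}(\sigma)$ with $\tau\cap\sigma=\emptyset$. (In particular $\mathrm{St}(\emptyset)=\mathrm{Lk}(\emptyset)=K$.) $K$ is an Eulerian sphere of dimension $k$ if $\bar{\boldsymbol\chi}(K)=(-1)^k$ and $\bar{\boldsymbol\chi}(\mathrm{Lk}(\sigma))=(-1)^{k-1-\dim\sigma}$ for every simplex $\sigma$ of $K$. The anti-incidence matrix of $K$ is the $\mathcal{P}\times\mathcal{P}$ matrix $J$ with $J_{\sigma,\tau}=(-1)^{\dim\sigma}$ if $\tau\cap\mathrm{St}(\sigma)=\emptyset$ (i.e. no vertex of $\tau$ lies in $\mathrm{St}(\sigma)$), and $J_{\sigma,\tau}=0$ otherwise. The column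 indexed by $\tau$ consists of the entries $J_{\sigma,\tau}$, $\sigma\in\mathcal{P}$. *)

theory Defs
  imports Complex_Main
begin

text \<open>A complex is represented by its set of simplices, each given by its finite set of
  vertices. The empty simplex always belongs to it, so \<^term>\<open>K\<close> is the index set that is
  usually written \<open>\<P>(K)\<close>.\<close>

definition finite_simplicial_complex :: "'a set set \<Rightarrow> bool" where
  "finite_simplicial_complex K \<longleftrightarrow>
     finite K \<and> {} \<in> K \<and> (\<forall>\<sigma>\<in>K. finite \<sigma> \<and> (\<forall>\<tau>. \<tau> \<subseteq> \<sigma> \<longrightarrow> \<tau> \<in> K))"

definition vertices :: "'a set set \<Rightarrow> 'a set" where
  "vertices K = \<Union>K"

definition flag_complex :: "'a set set \<Rightarrow> bool" where
  "flag_complex K \<longleftrightarrow>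
     (\<forall>A. A \<subseteq> vertices K \<and> pairwise (\<lambda>v w. {v, w} \<in> K) A \<longrightarrow> A \<in> K)"

definition simplex_dim :: "'a set \<Rightarrow> int" where
  "simplex_dim \<sigma> = int (card \<sigma>) - 1"

text \<open>Signs and matrix entries are taken in the reals, because dimensions may be \<open>-1\<close> and
  integer exponents (\<open>powi\<close>) need a type with inverses.\<close>

definition reduced_euler_char :: "'a set set \<Rightarrow> real" where
  "reduced_euler_char K = (\<Sum>\<sigma>\<in>K. (-1) powi simplex_dim \<sigma>)"

definition star :: "'a set set \<Rightarrow> 'a set \<Rightarrow> 'a set set" where
  "star K \<sigma> = {\<tau> \<in> K. \<tau> \<union> \<sigma> \<in> K}"

definition link :: "'a set set \<Rightarrow> 'a set \<Rightarrow> 'a set set" where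
  "link K \<sigma> = {\<tau> \<in> star K \<sigma>. \<tau> \<inter> \<sigma> = {}}"

text \<open>Only the parity of \<open>k\<close> matters here: the definition imposes no further relation
  between \<open>k\<close> and the dimensions of the simplices of \<open>K\<close>. The complex \<open>{{}}\<close> is an
  Eulerian sphere of dimension \<open>-1\<close>.\<close>

definition eulerian_sphere :: "int \<Rightarrow> 'a set set \<Rightarrow> bool" where
  "eulerian_sphere k K \<longleftrightarrow>
     reduced_euler_char K = (-1) powi k \<and>
     (\<forall>\<sigma>\<in>K. reduced_euler_char (link K \<sigma>) = (-1) powi (k - 1 - simplex_dim \<sigma>))"

text \<open>A matrix with rows and columns indexed by the simplices of \<open>K\<close> is a function of two
  simplices, of which only the values on \<open>K \<times> K\<close> are meaningful.\<close>

definition anti_incidence :: "'a set set \<Rightarrow> 'a set \<Rightarrow> 'a set \<Rightarrow> real" where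
  "anti_incidence K \<sigma> \<tau> =
     (if \<tau> \<inter> vertices (star K \<sigma>) = {} then (-1) powi simplex_dim \<sigma> else 0)"

end

theory Submission imports Defs begin

text \<open>Let \<open>C\<close> be the matrix with entry \<open>1\<close> at \<open>(\<sigma>, \<tau>)\<close> if \<open>\<sigma> \<union> \<tau> \<in> K\<close> and \<open>0\<close> otherwise,
  \<open>Z\<close> the inclusion matrix of the simplices and \<open>D\<close> the diagonal matrix of the signs
  \<open>(-1)^card \<sigma>\<close>. For a flag complex inclusion-exclusion over the vertices of \<open>\<tau>\<close> gives
  \<open>J = - D C D Z\<close>. On an Eulerian sphere, \<open>Z D C = c Z\<^sup>T\<close> with \<open>c = \<plusminus>1\<close>: the off-support entries
  are alternating sums over families invariant under adding or removing a fixed vertex, the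
  others are Euler characteristics of links. Transposing, also \<open>C D Z\<^sup>T = c Z\<close>, and since
  \<open>Z D Z = D\<close> we get \<open>J\<^sup>2 = D C D (Z D C) D Z = c D (C D Z\<^sup>T) D Z = c\<^sup>2 D (Z D Z) = 1\<close>.\<close>

section \<open>Signs and alternating sums over families of sets\<close>

lemma power_int_simplex_dim: "(-1::real) powi simplex_dim \<sigma> = - ((-1) ^ card \<sigma>)"
  by (simp add: simplex_dim_def power_int_diff)

text \<open>Adding \<open>v\<close> pairs the members of \<open>S\<close> that avoid
  \<open>v\<close> with those that contain it. Cardinalities within a pair differ by one, so the
  signs cancel.\<close>

lemma alternating_sum_toggle:
  fixes S :: "'a set set"
  assumes "finite S" "\<And>A. A \<in> S \<Longrightarrow> finite A"
    and "\<And>A. A \<in> S \<Longrightarrow> insert v A \<in> S" "\<And>A. A \<in> S \<Longrightarrow> A - {v} \<in> S"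
  shows "(\<Sum>A\<in>S. (-1::real) ^ card A) = 0"
proof -
  define S0 where "S0 = {A \<in> S. v \<notin> A}"
  define S1 where "S1 = {A \<in> S. v \<in> A}"
  have "S1 = insert v ` S0"
  proof
    show "S1 \<subseteq> insert v ` S0"
    proof
      fix A assume "A \<in> S1"
      then have "A - {v} \<in> S0" "A = insert v (A - {v})"
        using assms(4) by (auto simp: S0_def S1_def)
      then show "A \<in> insert v ` S0" by blast
    qed
  qed (use assms(3) in \<open>auto simp: S0_def S1_def\<close>)
  moreover have "inj_on (insert v) S0"
    by (auto simp: inj_on_def S0_def)
  ultimately have "(\<Sum>A\<in>S1. (-1::real) ^ card A) = (\<Sum>A\<in>S0. (-1) ^ card (insert v A))"
    by (simp add: sum.reindex)
  also have "\<dots> = (\<Sum>A\<in>S0. - ((-1) ^ card A))"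
    by (intro sum.cong) (auto simp: S0_def assms(2))
  finally have "(\<Sum>A\<in>S1. (-1::real) ^ card A) = - (\<Sum>A\<in>S0. (-1) ^ card A)"
    by (simp add: sum_negf)
  moreover have "S = S0 \<union> S1" "S0 \<inter> S1 = {}" "finite S0" "finite S1"
    using assms(1) by (auto simp: S0_def S1_def)
  ultimately show ?thesis by (simp add: sum.union_disjoint)
qed

text \<open>If \<open>A\<close> is a proper subset of \<open>B\<close>, any \<open>v\<close> in
  \<open>B - A\<close> can be toggled without leaving the interval. This is Moebius inversion on the
  Boolean lattice, the entrywise form of \<open>Z D Z = D\<close>.\<close>

lemma alternating_sum_interval:
  fixes A B :: "'a set"
  assumes "finite B"
  shows "(\<Sum>X | A \<subseteq> X \<and> X \<subseteq> B. (-1::real) ^ card X) = (if A = B then (-1) ^ card A else 0)"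
proof -
  consider "A = B" | "\<not> A \<subseteq> B" | v where "v \<in> B" "v \<notin> A" "A \<subseteq> B" by blast
  then show ?thesis
  proof cases
    case 1
    then have "{X. A \<subseteq> X \<and> X \<subseteq> B} = {A}" by auto
    with 1 show ?thesis by simp
  next
    case 2
    then have "{X. A \<subseteq> X \<and> X \<subseteq> B} = {}" "A \<noteq> B" by auto
    then show ?thesis by (simp only: sum.empty if_False)
  next
    case 3
    have "finite {X. A \<subseteq> X \<and> X \<subseteq> B}"
      by (rule finite_subset[of _ "Pow B"]) (use assms in auto)
    then have "(\<Sum>X | A \<subseteq> X \<and> X \<subseteq> B. (-1::real) ^ card X) = 0"
      by (rule alternating_sum_toggle[where v = v]) (use 3 assms finite_subset[of _ B] in auto)
    with 3 show ?thesis by auto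
  qed
qed

section \<open>Flag complexes, stars and the factorization of the anti-incidence matrix\<close>

context
  fixes K :: "'a set set"
  assumes K: "finite_simplicial_complex K"
begin

lemma finite_complex: "finite K"
  using K by (simp add: finite_simplicial_complex_def)

lemma finite_simplex: "\<sigma> \<in> K \<Longrightarrow> finite \<sigma>"
  using K by (simp add: finite_simplicial_complex_def)

lemma face_in_complex: "\<sigma> \<in> K \<Longrightarrow> \<tau> \<subseteq> \<sigma> \<Longrightarrow> \<tau> \<in> K"
  using K by (simp add: finite_simplicial_complex_def)

text \<open>This is where flagness enters: whether \<open>\<sigma>\<close> and \<open>A\<close> span
  a simplex can be tested one vertex of \<open>A\<close> at a time.\<close>

lemma flag_union_in_complex:
  assumes "flag_complex K" "\<sigma> \<in> K" "A \<in> K" "\<And>v. v \<in> A \<Longrightarrow> insert v \<sigma> \<in> K"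
  shows "\<sigma> \<union> A \<in> K"
proof -
  have "\<sigma> \<union> A \<subseteq> vertices K" using assms by (auto simp: vertices_def)
  moreover have "{v, w} \<in> K" if vw: "v \<in> \<sigma> \<union> A" "w \<in> \<sigma> \<union> A" for v w
  proof -
    \<comment> \<open>A mixed pair, with one end \<open>x\<close> in \<open>A\<close> and the other
      in \<open>\<sigma>\<close>, is a face of \<open>insert x \<sigma>\<close>.\<close>
    have "{v, w} \<subseteq> \<sigma> \<or> {v, w} \<subseteq> A \<or> (\<exists>x\<in>A. {v, w} \<subseteq> insert x \<sigma>)"
      using vw by auto
    then show ?thesis
    proof (elim disjE bexE)
      fix x assume "x \<in> A" "{v, w} \<subseteq> insert x \<sigma>"
      then show ?thesis using assms(4) face_in_complex[of "insert x \<sigma>"] by simp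
    qed (rule face_in_complex[OF assms(2)] face_in_complex[OF assms(3)], assumption)+
  qed
  then have "pairwise (\<lambda>v w. {v, w} \<in> K) (\<sigma> \<union> A)" by (simp add: pairwise_def)
  ultimately show ?thesis
    using assms(1) unfolding flag_complex_def by blast
qed

lemma vertices_star: "v \<in> vertices (star K \<sigma>) \<longleftrightarrow> insert v \<sigma> \<in> K"
proof
  assume "v \<in> vertices (star K \<sigma>)"
  then obtain \<tau> where "v \<in> \<tau>" "\<tau> \<union> \<sigma> \<in> K" by (auto simp: vertices_def star_def)
  then show "insert v \<sigma> \<in> K" using face_in_complex[of "\<tau> \<union> \<sigma>" "insert v \<sigma>"] by simp
next
  assume "insert v \<sigma> \<in> K"
  then have "{v} \<in> star K \<sigma>"
    using face_in_complex[of "insert v \<sigma>" "{v}"] by (simp add: star_def)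
  then show "v \<in> vertices (star K \<sigma>)" unfolding vertices_def by blast
qed

text \<open>Entrywise form of \<open>J = - D C D Z\<close>. The sum runs over the faces of
  \<open>\<tau>\<close> that span a simplex with \<open>\<sigma>\<close>; these are all subsets of
  one set \<open>B\<close>, so it detects whether \<open>B\<close> is empty. The minus sign comes
  from the dimension being the cardinality minus one.\<close>

lemma anti_incidence_eq_sum:
  assumes "flag_complex K" "\<sigma> \<in> K" "\<tau> \<in> K"
  shows "anti_incidence K \<sigma> \<tau> =
    - ((-1) ^ card \<sigma>) * (\<Sum>A\<in>K. of_bool (\<sigma> \<union> A \<in> K) * of_bool (A \<subseteq> \<tau>) * (-1) ^ card A)"
proof -
  define B where "B = \<tau> \<inter> vertices (star K \<sigma>)"
  have B: "B \<in> K" "finite B"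
    using assms(3) face_in_complex finite_simplex by (auto simp: B_def)
  \<comment> \<open>The bound \<open>{} \<subseteq> A\<close> only brings the family into the shape
    of an interval.\<close>
  have "{A \<in> K. \<sigma> \<union> A \<in> K \<and> A \<subseteq> \<tau>} = {A. {} \<subseteq> A \<and> A \<subseteq> B}"
  proof (intro set_eqI iffI)
    fix A assume A: "A \<in> {A \<in> K. \<sigma> \<union> A \<in> K \<and> A \<subseteq> \<tau>}"
    have "insert v \<sigma> \<in> K" if "v \<in> A" for v
      using A that face_in_complex[of "\<sigma> \<union> A" "insert v \<sigma>"] by auto
    then show "A \<in> {A. {} \<subseteq> A \<and> A \<subseteq> B}"
      using A by (auto simp: B_def vertices_star)
  next
    fix A assume "A \<in> {A. {} \<subseteq> A \<and> A \<subseteq> B}"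
    then have A: "A \<subseteq> B" by simp
    then have "A \<in> K" using B(1) face_in_complex by blast
    moreover have "insert v \<sigma> \<in> K" if "v \<in> A" for v
      using A that by (auto simp: B_def vertices_star)
    ultimately show "A \<in> {A \<in> K. \<sigma> \<union> A \<in> K \<and> A \<subseteq> \<tau>}"
      using A assms flag_union_in_complex by (auto simp: B_def)
  qed
  then have "(\<Sum>A | A \<in> K \<and> \<sigma> \<union> A \<in> K \<and> A \<subseteq> \<tau>. (-1::real) ^ card A) =
      (if B = {} then 1 else 0)"
    using alternating_sum_interval[OF B(2), of "{}"] by auto
  moreover have "(\<Sum>A\<in>K. of_bool (\<sigma> \<union> A \<in> K) * of_bool (A \<subseteq> \<tau>) * (-1::real) ^ card A) =
      (\<Sum>A | A \<in> K \<and> \<sigma> \<union> A \<in> K \<and> A \<subseteq> \<tau>. (-1) ^ card A)"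
    by (rule sum.mono_neutral_cong_right) (auto simp: finite_complex)
  ultimately show ?thesis
    by (simp add: anti_incidence_def B_def power_int_simplex_dim)
qed

section \<open>Alternating sums over cofaces\<close>

lemma alternating_sum_cofaces_eq_0:
  assumes "\<not> \<tau> \<subseteq> A"
  shows "(\<Sum>\<rho>\<in>K. of_bool (A \<subseteq> \<rho>) * (-1::real) ^ card \<rho> * of_bool (\<rho> \<union> \<tau> \<in> K)) = 0"
proof -
  \<comment> \<open>Toggling this \<open>v\<close> in \<open>\<rho>\<close> preserves
    \<open>A \<subseteq> \<rho>\<close> because \<open>v\<close> is not in \<open>A\<close>, and
    leaves \<open>\<rho> \<union> \<tau>\<close> unchanged because \<open>v\<close> is in
    \<open>\<tau>\<close>.\<close>
  obtain v where v: "v \<in> \<tau>" "v \<notin> A" using assms by blast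
  have insert: "insert v \<rho> \<in> K" if "\<rho> \<union> \<tau> \<in> K" for \<rho>
    by (rule face_in_complex[OF that]) (use v(1) in auto)
  have remove: "\<rho> - {v} \<in> K" if "\<rho> \<in> K" for \<rho>
    using that by (rule face_in_complex) auto
  have union: "insert v \<rho> \<union> \<tau> = \<rho> \<union> \<tau>" "(\<rho> - {v}) \<union> \<tau> = \<rho> \<union> \<tau>" for \<rho>
    using v(1) by auto
  have "(\<Sum>\<rho>\<in>K. of_bool (A \<subseteq> \<rho>) * (-1::real) ^ card \<rho> * of_bool (\<rho> \<union> \<tau> \<in> K)) =
      (\<Sum>\<rho> | \<rho> \<in> K \<and> A \<subseteq> \<rho> \<and> \<rho> \<union> \<tau> \<in> K. (-1) ^ card \<rho>)"
    by (rule sum.mono_neutral_cong_right) (auto simp: finite_complex)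
  also have "\<dots> = 0"
  proof (rule alternating_sum_toggle[where v = v])
    show "finite {\<rho> \<in> K. A \<subseteq> \<rho> \<and> \<rho> \<union> \<tau> \<in> K}" by (simp add: finite_complex)
  next
    fix \<rho> assume \<rho>: "\<rho> \<in> {\<rho> \<in> K. A \<subseteq> \<rho> \<and> \<rho> \<union> \<tau> \<in> K}"
    then show "finite \<rho>" by (simp add: finite_simplex)
    show "insert v \<rho> \<in> {\<rho> \<in> K. A \<subseteq> \<rho> \<and> \<rho> \<union> \<tau> \<in> K}"
      using \<rho> unfolding mem_Collect_eq union by (blast intro: insert)
    show "\<rho> - {v} \<in> {\<rho> \<in> K. A \<subseteq> \<rho> \<and> \<rho> \<union> \<tau> \<in> K}"
      using \<rho> v(2) unfolding mem_Collect_eq union by (blast intro: remove)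
  qed
  finally show ?thesis .
qed

lemma alternating_sum_star:
  "(\<Sum>\<sigma>\<in>K. (-1) ^ card \<sigma> * of_bool (\<sigma> \<union> A \<in> K)) =
    - (if A = {} then reduced_euler_char K else 0)"
proof (cases "A = {}")
  case True
  then show ?thesis
    by (simp add: reduced_euler_char_def power_int_simplex_dim sum_negf)
next
  case False
  then show ?thesis
    using alternating_sum_cofaces_eq_0[of A "{}"] by simp
qed

text \<open>Entrywise form of \<open>Z D C = c Z\<^sup>T\<close> with
  \<open>c = - ((-1) powi k)\<close>. For \<open>\<tau> \<subseteq> A\<close> every coface of
  \<open>A\<close> counts, and removing \<open>A\<close> turns the cofaces into the simplices of its
  link.\<close>

lemma alternating_sum_cofaces:
  assumes "eulerian_sphere k K" "A \<in> K"
  shows "(\<Sum>\<rho>\<in>K. of_bool (A \<subseteq> \<rho>) * (-1::real) ^ card \<rho> * of_bool (\<rho> \<union> \<tau> \<in> K)) =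
    - ((-1) powi k) * of_bool (\<tau> \<subseteq> A)"
proof (cases "\<tau> \<subseteq> A")
  case False
  then show ?thesis by (simp add: alternating_sum_cofaces_eq_0)
next
  case True
  have link: "{\<rho> \<in> K. A \<subseteq> \<rho>} = (\<lambda>\<rho>. \<rho> \<union> A) ` link K A"
  proof
    show "{\<rho> \<in> K. A \<subseteq> \<rho>} \<subseteq> (\<lambda>\<rho>. \<rho> \<union> A) ` link K A"
    proof
      fix \<rho> assume \<rho>: "\<rho> \<in> {\<rho> \<in> K. A \<subseteq> \<rho>}"
      then have "\<rho> = (\<rho> - A) \<union> A" "\<rho> - A \<in> K"
        using face_in_complex[of \<rho> "\<rho> - A"] by auto
      with \<rho> show "\<rho> \<in> (\<lambda>\<rho>. \<rho> \<union> A) ` link K A"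
        by (intro image_eqI[of _ _ "\<rho> - A"]) (auto simp: link_def star_def)
    qed
  qed (auto simp: link_def star_def)
  have inj: "inj_on (\<lambda>\<rho>. \<rho> \<union> A) (link K A)"
    by (auto simp: inj_on_def link_def)
  have "(\<Sum>\<rho>\<in>K. of_bool (A \<subseteq> \<rho>) * (-1::real) ^ card \<rho> * of_bool (\<rho> \<union> \<tau> \<in> K)) =
      (\<Sum>\<rho> | \<rho> \<in> K \<and> A \<subseteq> \<rho>. (-1) ^ card \<rho>)"
  proof (rule sum.mono_neutral_cong_right)
    fix \<rho> assume \<rho>: "\<rho> \<in> {\<rho> \<in> K. A \<subseteq> \<rho>}"
    then have "\<rho> \<union> \<tau> = \<rho>" using True by auto
    with \<rho> show "of_bool (A \<subseteq> \<rho>) * (-1::real) ^ card \<rho> * of_bool (\<rho> \<union> \<tau> \<in> K) = (-1) ^ card \<rho>"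
      by simp
  qed (auto simp: finite_complex)
  also have "\<dots> = (\<Sum>\<rho>\<in>link K A. (-1) ^ card (\<rho> \<union> A))"
    unfolding link by (simp add: sum.reindex inj)
  also have "\<dots> = (\<Sum>\<rho>\<in>link K A. (-1) ^ card A * (-1) ^ card \<rho>)"
    using assms(2)
    by (intro sum.cong)
      (auto simp: link_def star_def card_Un_disjoint finite_simplex power_add)
  also have "\<dots> = - ((-1) ^ card A * reduced_euler_char (link K A))"
    by (simp add: reduced_euler_char_def power_int_simplex_dim sum_negf sum_distrib_left)
  \<comment> \<open>The exponent is \<open>k - 1 - simplex_dim A\<close>; its dependence on
    \<open>A\<close> cancels against the sign split off from \<open>A\<close>.\<close>
  also have "\<dots> = - ((-1) ^ card A * (-1) powi (k - int (card A)))"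
    using assms by (simp add: eulerian_sphere_def simplex_dim_def)
  also have "\<dots> = - ((-1) powi k)"
    by (simp add: power_int_diff)
  finally show ?thesis using True by simp
qed

section \<open>Column sums and the square of the matrix\<close>

lemma column_sum_anti_incidence:
  assumes "flag_complex K" "\<tau> \<in> K"
  shows "(\<Sum>\<sigma>\<in>K. anti_incidence K \<sigma> \<tau>) = reduced_euler_char K"
proof -
  have "(\<Sum>\<sigma>\<in>K. anti_incidence K \<sigma> \<tau>) =
      (\<Sum>\<sigma>\<in>K. \<Sum>A\<in>K. - of_bool (A \<subseteq> \<tau>) * (-1) ^ card A *
        ((-1) ^ card \<sigma> * of_bool (\<sigma> \<union> A \<in> K)))"
    using assms
    by (simp add: anti_incidence_eq_sum sum_distrib_left sum_negf mult_ac)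
  also have "\<dots> = (\<Sum>A\<in>K. - of_bool (A \<subseteq> \<tau>) * (-1) ^ card A *
      (\<Sum>\<sigma>\<in>K. (-1) ^ card \<sigma> * of_bool (\<sigma> \<union> A \<in> K)))"
    unfolding sum_distrib_left by (rule sum.swap)
  \<comment> \<open>Only the empty face survives, and there the two minus signs cancel.\<close>
  also have "\<dots> = (\<Sum>A\<in>K. if A = {} then reduced_euler_char K else 0)"
    by (intro sum.cong refl) (simp add: alternating_sum_star)
  also have "\<dots> = reduced_euler_char K"
    using assms(2) face_in_complex[of \<tau> "{}"] finite_complex by simp
  finally show ?thesis .
qed

lemma anti_incidence_involution:
  assumes "flag_complex K" "eulerian_sphere k K" "\<sigma> \<in> K" "\<tau> \<in> K"
  shows "(\<Sum>\<rho>\<in>K. anti_incidence K \<sigma> \<rho> * anti_incidence K \<rho> \<tau>) = (if \<sigma> = \<tau> then 1 else 0)"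
proof -
  define e where "e A = (-1::real) ^ card A" for A :: "'a set"
  define c where "c = - ((-1::real) powi k)"
  have "c * c = 1" by (simp add: c_def flip: power_int_mult_distrib)
  then have cc: "c * (c * x) = x" for x by (simp flip: mult.assoc)
  have cofaces: "(\<Sum>\<rho>\<in>K. of_bool (A \<subseteq> \<rho>) * e \<rho> * of_bool (\<rho> \<union> B \<in> K)) = c * of_bool (B \<subseteq> A)"
    if "A \<in> K" for A B
    using alternating_sum_cofaces[OF assms(2) that] by (simp add: e_def c_def)
  have J: "anti_incidence K \<alpha> \<beta> =
      - e \<alpha> * (\<Sum>A\<in>K. of_bool (\<alpha> \<union> A \<in> K) * of_bool (A \<subseteq> \<beta>) * e A)"
    if "\<alpha> \<in> K" "\<beta> \<in> K" for \<alpha> \<beta>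
    using anti_incidence_eq_sum[OF assms(1) that] by (simp add: e_def)
  have "(\<Sum>\<rho>\<in>K. anti_incidence K \<sigma> \<rho> * anti_incidence K \<rho> \<tau>) =
      (\<Sum>\<rho>\<in>K. e \<sigma> * (e \<rho> * ((\<Sum>B\<in>K. of_bool (\<rho> \<union> B \<in> K) * of_bool (B \<subseteq> \<tau>) * e B) *
        (\<Sum>A\<in>K. of_bool (\<sigma> \<union> A \<in> K) * of_bool (A \<subseteq> \<rho>) * e A))))"
    using assms by (intro sum.cong refl) (simp add: J mult_ac)
  also have "\<dots> = e \<sigma> * (\<Sum>\<rho>\<in>K. \<Sum>B\<in>K. \<Sum>A\<in>K. of_bool (B \<subseteq> \<tau>) * e B * (of_bool (\<sigma> \<union> A \<in> K) * e A *
        (of_bool (A \<subseteq> \<rho>) * e \<rho> * of_bool (\<rho> \<union> B \<in> K))))"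
    unfolding sum_product by (simp only: sum_distrib_left mult_ac)
  \<comment> \<open>The sum over the middle index \<open>\<rho>\<close> moves inside, where it
    becomes an entry of \<open>Z D C\<close>.\<close>
  also have "\<dots> = e \<sigma> * (\<Sum>B\<in>K. \<Sum>A\<in>K. \<Sum>\<rho>\<in>K. of_bool (B \<subseteq> \<tau>) * e B * (of_bool (\<sigma> \<union> A \<in> K) * e A *
        (of_bool (A \<subseteq> \<rho>) * e \<rho> * of_bool (\<rho> \<union> B \<in> K))))"
    by (rule arg_cong[where f = "(*) (e \<sigma>)"], rule trans[OF sum.swap], rule sum.cong[OF refl],
        rule sum.swap)
  also have "\<dots> = e \<sigma> * (\<Sum>B\<in>K. of_bool (B \<subseteq> \<tau>) * e B * (\<Sum>A\<in>K. of_bool (\<sigma> \<union> A \<in> K) * e A *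
        (\<Sum>\<rho>\<in>K. of_bool (A \<subseteq> \<rho>) * e \<rho> * of_bool (\<rho> \<union> B \<in> K))))"
    by (simp only: sum_distrib_left)
  also have "\<dots> = e \<sigma> * (\<Sum>B\<in>K. of_bool (B \<subseteq> \<tau>) * e B *
        (\<Sum>A\<in>K. of_bool (\<sigma> \<union> A \<in> K) * e A * (c * of_bool (B \<subseteq> A))))"
    by (simp add: cofaces)
  \<comment> \<open>Since \<open>C\<close> is symmetric, the remaining sum over \<open>A\<close> is
    again a coface sum, now for \<open>B\<close> and \<open>\<sigma>\<close>; it yields a second
    factor \<open>c\<close>, and \<open>c * c = 1\<close>.\<close>
  also have "\<dots> = e \<sigma> * (\<Sum>B\<in>K. of_bool (B \<subseteq> \<tau>) * e B *
        (c * (\<Sum>A\<in>K. of_bool (B \<subseteq> A) * e A * of_bool (A \<union> \<sigma> \<in> K))))"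
    by (simp only: sum_distrib_left mult_ac Un_commute)
  also have "\<dots> = e \<sigma> * (\<Sum>B\<in>K. of_bool (\<sigma> \<subseteq> B \<and> B \<subseteq> \<tau>) * e B)"
    by (simp add: cofaces cc) (simp add: of_bool_conj mult_ac)
  \<comment> \<open>Every subset of \<open>\<tau>\<close> is a simplex, so the sum covers the whole
    interval from \<open>\<sigma>\<close> to \<open>\<tau>\<close>.\<close>
  also have "(\<Sum>B\<in>K. of_bool (\<sigma> \<subseteq> B \<and> B \<subseteq> \<tau>) * e B) = (\<Sum>B | \<sigma> \<subseteq> B \<and> B \<subseteq> \<tau>. e B)"
    using assms(4) face_in_complex
    by (intro sum.mono_neutral_cong_right) (auto simp: finite_complex)
  also have "\<dots> = (if \<sigma> = \<tau> then e \<sigma> else 0)"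
    unfolding e_def by (rule alternating_sum_interval) (simp add: assms finite_simplex)
  finally show ?thesis
    by (simp add: e_def flip: power_add mult_2)
qed

end

theorem theorem7p6:
  fixes K :: "'a set set"
  assumes "finite_simplicial_complex K"
    and "flag_complex K"
  shows "(\<forall>\<tau>\<in>K. (\<Sum>\<sigma>\<in>K. anti_incidence K \<sigma> \<tau>) = reduced_euler_char K) \<and>
         ((\<exists>k. eulerian_sphere k K) \<longrightarrow>
            (\<forall>\<sigma>\<in>K. \<forall>\<tau>\<in>K.
               (\<Sum>\<rho>\<in>K. anti_incidence K \<sigma> \<rho> * anti_incidence K \<rho> \<tau>) =
               (if \<sigma> = \<tau> then 1 else 0)))"
  using column_sum_anti_incidence[OF assms] anti_incidence_involution[OF assms] by blast

end
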